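(* Let $\Bbbk$ be a field of characteristic zero. Let $B$ be a Poisson domain over $\Bbbk$ that is integrally closed (in its fraction field) as a commutative algebra and that is Dixmier. Let $A$ be a Poisson subalgebra of $B$ with $\dim_\Bbbk B/A<\infty$ and such that $B\subseteq Q(A)$, where $Q(A)$ is the fraction field of $A$. Then $A$ also satisfies the Dixmier property.
   Context: Poisson algebras are commutative as associative algebras; a Poisson domain is a Poisson $\Bbbk$-algebra which is an integral domain. A Poisson $\Bbbk$-algebra $A$ is Dixmier (satisfies the Dixmier property) if every injective Poisson $\Bbbk$-algebra morphism $A\to A$ is bijective. *)

theory Defs
  imports
    "HOL-Computational_Algebra.Polynomial_Factorial"
    "HOL-Library.Set_Algebras"
begin

text \<open>A Poisson algebra lives on a whole type, the scalar action and the bracket being explicit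
  parameters. Right linearity of the bracket is assumed separately: antisymmetry is derived
  from \<^term>\<open>bracket x x = 0\<close> by means of it.\<close>

locale poisson_algebra = vector_space scale
  for scale :: "'k::field \<Rightarrow> 'a::comm_ring_1 \<Rightarrow> 'a" (infixr \<open>*s\<close> 75) +
  fixes bracket :: "'a \<Rightarrow> 'a \<Rightarrow> 'a"
  assumes scale_mult: "(c *s x) * y = c *s (x * y)"
    and bracket_add_left: "bracket (x + y) z = bracket x z + bracket y z"
    and bracket_add_right: "bracket x (y + z) = bracket x y + bracket x z"
    and bracket_scale_left: "bracket (c *s x) y = c *s bracket x y"
    and bracket_scale_right: "bracket x (c *s y) = c *s bracket x y"
    and bracket_self: "bracket x x = 0"
    and jacobi: "bracket x (bracket y z) + bracket y (bracket z x) + bracket z (bracket x y) = 0"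
    and leibniz: "bracket x (y * z) = bracket x y * z + y * bracket x z"

definition poisson_subalgebra ::
    "('k::field \<Rightarrow> 'a::comm_ring_1 \<Rightarrow> 'a) \<Rightarrow> ('a \<Rightarrow> 'a \<Rightarrow> 'a) \<Rightarrow> 'a set \<Rightarrow> bool" where
  "poisson_subalgebra scale bracket A \<longleftrightarrow>
     module.subspace scale A \<and> 1 \<in> A \<and>
     (\<forall>x\<in>A. \<forall>y\<in>A. x * y \<in> A) \<and> (\<forall>x\<in>A. \<forall>y\<in>A. bracket x y \<in> A)"

text \<open>Endomorphisms of a Poisson subalgebra \<open>A\<close>; only the values of \<open>f\<close> on \<open>A\<close> matter.\<close>

definition poisson_endo_on ::
    "('k::field \<Rightarrow> 'a::comm_ring_1 \<Rightarrow> 'a) \<Rightarrow> ('a \<Rightarrow> 'a \<Rightarrow> 'a) \<Rightarrow> 'a set \<Rightarrow> ('a \<Rightarrow> 'a) \<Rightarrow> bool" where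
  "poisson_endo_on scale bracket A f \<longleftrightarrow>
     f ` A \<subseteq> A \<and> f 1 = 1 \<and>
     (\<forall>x\<in>A. \<forall>y\<in>A. f (x + y) = f x + f y) \<and>
     (\<forall>c. \<forall>x\<in>A. f (scale c x) = scale c (f x)) \<and>
     (\<forall>x\<in>A. \<forall>y\<in>A. f (x * y) = f x * f y) \<and>
     (\<forall>x\<in>A. \<forall>y\<in>A. f (bracket x y) = bracket (f x) (f y))"

definition dixmier_on ::
    "('k::field \<Rightarrow> 'a::comm_ring_1 \<Rightarrow> 'a) \<Rightarrow> ('a \<Rightarrow> 'a \<Rightarrow> 'a) \<Rightarrow> 'a set \<Rightarrow> bool" where
  "dixmier_on scale bracket A \<longleftrightarrow>
     (\<forall>f. poisson_endo_on scale bracket A f \<longrightarrow> inj_on f A \<longrightarrow> bij_betw f A A)"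

definition integral_element :: "'a::idom fract \<Rightarrow> bool" where
  "integral_element x \<longleftrightarrow>
     (\<exists>p :: 'a poly. lead_coeff p = 1 \<and> poly (map_poly to_fract p) x = 0)"

text \<open>The type \<open>'a\<close> enters only through its fraction field, hence the \<open>itself\<close> argument.\<close>

definition integrally_closed :: "'a::idom itself \<Rightarrow> bool" where
  "integrally_closed _ \<longleftrightarrow>
     (\<forall>x :: 'a fract. integral_element x \<longrightarrow> x \<in> range to_fract)"

text \<open>The fraction field of a subring \<open>A\<close>, realised as a subfield of the fraction field of the
  ambient domain.\<close>

definition fraction_field_of :: "'a::idom set \<Rightarrow> 'a fract set" where
  "fraction_field_of A = {to_fract a / to_fract s | a s. a \<in> A \<and> s \<in> A \<and> s \<noteq> 0}"

text \<open>The quotient of the ambient space by a subspace \<open>A\<close> has the cosets \<open>b +o A\<close> as elements.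
  It is finite-dimensional if it is spanned by the cosets of finitely many vectors \<open>v \<in> F\<close>;
  linear combinations of cosets are formed on representatives.\<close>

definition finite_dim_quotient ::
    "('k::field \<Rightarrow> 'a::comm_ring_1 \<Rightarrow> 'a) \<Rightarrow> 'a set \<Rightarrow> bool" where
  "finite_dim_quotient scale A \<longleftrightarrow>
     (\<exists>F. finite F \<and>
       (\<forall>C \<in> range (\<lambda>b. b +o A). \<exists>c. C = (\<Sum>v\<in>F. scale (c v) v) +o A))"

end

theory Submission
  imports Defs
begin

text \<open>
  Since \<open>B/A\<close> is finite-dimensional, the powers of \<open>b \<in> B\<close> are linearly dependent modulo \<open>A\<close>, so
  \<open>b\<close> is integral over \<open>A\<close>. Let \<open>f\<close> be an injective Poisson endomorphism of \<open>A\<close> and write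
  \<open>b = a/s\<close> with \<open>a, s \<in> A\<close>. Then \<open>f a/f s\<close> satisfies the image of the integral equation of \<open>b\<close>,
  hence lies in \<open>B\<close>. So \<open>f\<close> extends to an injective Poisson endomorphism \<open>F\<close> of \<open>B\<close>, which is
  bijective by assumption. The induced endomorphism of the finite-dimensional space \<open>B/A\<close> is
  surjective, hence injective, which means that \<open>F x \<in> A\<close> implies \<open>x \<in> A\<close>; so \<open>f\<close> maps onto \<open>A\<close>.
\<close>

section \<open>Linear algebra modulo a subspace of finite codimension\<close>

context vector_space
begin

text \<open>Induction on \<open>F\<close>, moving \<open>v\<close> into the base set
  \<open>S\<close>. If the term found then really involves \<open>v\<close>, the exchange lemma
  expresses \<open>v\<close> through \<open>S\<close> and \<open>x 0, ..., x n\<close>, so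
  \<open>v\<close> can be traded for these terms. This is why \<open>S\<close> and \<open>x\<close>
  must vary in the induction.\<close>

lemma sequence_dependent_modulo:
  assumes "finite F" and "\<And>n. x n \<in> span (S \<union> F)"
  shows "\<exists>n::nat. x n \<in> span (S \<union> x ` {..<n})"
  using assms
proof (induction F arbitrary: S x rule: finite_induct)
  case empty
  then have "x 0 \<in> span (S \<union> x ` {..<0})"
    by simp
  then show ?case by blast
next
  case (insert v F)
  have "\<And>n. x n \<in> span (insert v S \<union> F)"
    using insert.prems by simp
  from insert.IH[of x "insert v S", OF this] obtain n where n: "x n \<in> span (insert v (S \<union> x ` {..<n}))"
    by auto
  show ?case
  proof (cases "x n \<in> span (S \<union> x ` {..<n})")
    case True
    then show ?thesis by blast
  next
    case False
    then have v: "v \<in> span (insert (x n) (S \<union> x ` {..<n}))"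
      using n in_span_insert by blast
    have eq: "insert (x n) (S \<union> x ` {..<n}) = S \<union> x ` {..n}"
      by (auto simp: lessThan_Suc_atMost[symmetric] lessThan_Suc)
    have "insert v S \<union> F \<subseteq> span ((S \<union> x ` {..n}) \<union> F)"
      using v[unfolded eq] span_mono[of "S \<union> x ` {..n}" "(S \<union> x ` {..n}) \<union> F"]
      by (auto intro: span_base)
    then have "span (S \<union> insert v F) \<subseteq> span ((S \<union> x ` {..n}) \<union> F)"
      by (intro span_minimal) auto
    then have "\<And>m. x (Suc n + m) \<in> span ((S \<union> x ` {..n}) \<union> F)"
      using insert.prems by blast
    \<comment> \<open>The terms up to \<open>x n\<close> are now in the base set, so the induction
      hypothesis is applied to the tail of the sequence that follows them.\<close>
    from insert.IH[of "\<lambda>m. x (Suc n + m)" "S \<union> x ` {..n}", OF this]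
    obtain m where "x (Suc n + m) \<in> span ((S \<union> x ` {..n}) \<union> (\<lambda>m. x (Suc n + m)) ` {..<m})"
      by blast
    moreover have "(S \<union> x ` {..n}) \<union> (\<lambda>m. x (Suc n + m)) ` {..<m} \<subseteq> S \<union> x ` {..<Suc n + m}"
      by auto
    ultimately show ?thesis
      using span_mono by blast
  qed
qed

text \<open>The preimages of \<open>A\<close> under the iterates of \<open>F\<close> form an ascending chain, which becomes
  stationary because \<open>A\<close> has finite codimension.\<close>

lemma surj_preimage_finite_codim:
  assumes A: "subspace A" and "finite G" and G: "span (A \<union> G) = UNIV"
    and add: "\<And>x y. F (x + y) = F x + F y" and sc: "\<And>c x. F (c *s x) = c *s F x"
    and FA: "F ` A \<subseteq> A" and "surj F" and Fx: "F x \<in> A"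
  shows "x \<in> A"
proof -
  define K where "K n = {y. (F ^^ n) y \<in> A}" for n
  have F0: "F 0 = 0"
    using sc[of 0 0] by simp
  have add_n: "(F ^^ n) (y + z) = (F ^^ n) y + (F ^^ n) z" for n y z
    by (induction n) (auto simp: add)
  have sc_n: "(F ^^ n) (c *s y) = c *s (F ^^ n) y" for n c y
    by (induction n) (auto simp: sc)
  have zero_n: "(F ^^ n) 0 = 0" for n
    by (induction n) (auto simp: F0)
  have sub: "subspace (K n)" for n
    using A unfolding K_def subspace_def by (auto simp: add_n sc_n zero_n)
  have "K n \<subseteq> K (Suc n)" for n
    using FA by (auto simp: K_def)
  then have mono: "m \<le> n \<Longrightarrow> K m \<subseteq> K n" for m n
    by (rule lift_Suc_mono_le)
  have "\<exists>n. K (Suc n) \<subseteq> K n"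
  proof (rule ccontr)
    assume "\<not> ?thesis"
    then have "\<forall>n. \<exists>y. y \<in> K (Suc n) \<and> y \<notin> K n"
      by blast
    then obtain y where y: "\<And>n. y n \<in> K (Suc n)" "\<And>n. y n \<notin> K n"
      by metis
    \<comment> \<open>In a strictly ascending chain \<open>y i\<close> would lie in
      \<open>K (Suc i)\<close> but not in \<open>K i\<close>. A dependent term contradicts this,
      since \<open>A\<close> and all earlier terms lie in \<open>K n\<close>.\<close>
    obtain n where n: "y n \<in> span (A \<union> y ` {..<n})"
      using sequence_dependent_modulo[OF \<open>finite G\<close>, of y A] G by auto
    have "A \<subseteq> K n"
      using mono[of 0 n] by (simp add: K_def)
    moreover have "y i \<in> K n" if "i < n" for i
      using mono[of "Suc i" n] that y(1)[of i] by auto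
    ultimately have "span (A \<union> y ` {..<n}) \<subseteq> K n"
      by (intro span_minimal sub) auto
    then show False
      using n y(2) by blast
  qed
  then obtain n where n: "K (Suc n) \<subseteq> K n" by blast
  \<comment> \<open>Pulling \<open>x\<close> back along \<open>F ^^ n\<close> turns
    \<open>F x \<in> A\<close> into membership in \<open>K (Suc n)\<close> and
    \<open>x \<in> A\<close> into membership in \<open>K n\<close>.\<close>
  have "surj (F ^^ n)"
    using \<open>surj F\<close> by (rule surj_fn)
  then obtain z where z: "x = (F ^^ n) z"
    by (metis surjD)
  have "z \<in> K (Suc n)"
    using Fx by (simp add: K_def z)
  then show ?thesis
    using n z by (auto simp: K_def)
qed

end

section \<open>An injective endomorphism of \<open>A\<close>: setting and basic rules\<close>

locale poisson_endo_extension = poisson_algebra scale bracket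
  for scale :: "'k::field \<Rightarrow> 'b::idom \<Rightarrow> 'b" (infixr \<open>*s\<close> 75) and bracket +
  fixes A G :: "'b set" and f :: "'b \<Rightarrow> 'b"
  assumes closed: "integrally_closed TYPE('b)"
    and subalgebra: "poisson_subalgebra scale bracket A"
    and finite_G: "finite G" and span_G: "span (A \<union> G) = UNIV"
    and fractions: "range to_fract \<subseteq> fraction_field_of A"
    and endo: "poisson_endo_on scale bracket A f"
    and inj: "inj_on f A"
begin

lemma subspace_A: "subspace A"
  and one_A: "1 \<in> A"
  and mult_A: "x \<in> A \<Longrightarrow> y \<in> A \<Longrightarrow> x * y \<in> A"
  and bracket_A: "x \<in> A \<Longrightarrow> y \<in> A \<Longrightarrow> bracket x y \<in> A"
  using subalgebra by (auto simp: poisson_subalgebra_def)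

lemmas zero_A = subspace_0[OF subspace_A]
  and add_A = subspace_add[OF subspace_A]
  and scale_A = subspace_scale[OF subspace_A]

lemma power_A: "x \<in> A \<Longrightarrow> x ^ n \<in> A"
  by (induction n) (auto intro: one_A mult_A)

lemma sum_A: "(\<And>i. i \<in> I \<Longrightarrow> g i \<in> A) \<Longrightarrow> sum g I \<in> A"
  by (rule subspace_sum[OF subspace_A])

lemma f_A: "x \<in> A \<Longrightarrow> f x \<in> A"
  and f_1: "f 1 = 1"
  and f_add: "x \<in> A \<Longrightarrow> y \<in> A \<Longrightarrow> f (x + y) = f x + f y"
  and f_scale: "x \<in> A \<Longrightarrow> f (c *s x) = c *s f x"
  and f_mult: "x \<in> A \<Longrightarrow> y \<in> A \<Longrightarrow> f (x * y) = f x * f y"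
  and f_bracket: "x \<in> A \<Longrightarrow> y \<in> A \<Longrightarrow> f (bracket x y) = bracket (f x) (f y)"
  using endo by (auto simp: poisson_endo_on_def)

lemma f_0: "f 0 = 0"
  using f_scale[OF zero_A, of 0] by simp

lemma f_eq_0_iff: "x \<in> A \<Longrightarrow> f x = 0 \<longleftrightarrow> x = 0"
  using inj_onD[OF inj, of x 0] zero_A f_0 by auto

lemma f_power: "x \<in> A \<Longrightarrow> f (x ^ n) = f x ^ n"
  by (induction n) (auto simp: f_1 f_mult power_A)

lemma f_sum: "(\<And>i. i \<in> I \<Longrightarrow> g i \<in> A) \<Longrightarrow> f (sum g I) = (\<Sum>i\<in>I. f (g i))"
  by (induction I rule: infinite_finite_induct) (auto simp: f_0 f_add sum_A)

lemma scale_eq_mult: "c *s x = (c *s 1) * x"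
  by (simp add: scale_mult)

lemma bracket_antisym: "bracket x y = - bracket y x"
proof -
  have "bracket x y + bracket y x = bracket (x + y) (x + y)"
    unfolding bracket_add_left bracket_add_right by (simp add: bracket_self)
  also have "\<dots> = 0"
    by (rule bracket_self)
  finally show ?thesis
    by (simp add: eq_neg_iff_add_eq_0)
qed

lemma bracket_mult_left: "bracket (s * y) x = s * bracket y x + y * bracket s x"
  using leibniz[of x s y] bracket_antisym[of _ x] by (simp add: algebra_simps)

section \<open>Denominators, integrality and construction of the extension\<close>

lemma denominator:
  obtains s where "s \<in> A" "s \<noteq> 0" "s * b \<in> A"
proof -
  have "to_fract b \<in> fraction_field_of A"
    using fractions by blast
  then obtain a s where as: "a \<in> A" "s \<in> A" "s \<noteq> 0" "to_fract b = to_fract a / to_fract s"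
    by (auto simp: fraction_field_of_def)
  then have "to_fract (s * b) = to_fract a"
    by simp
  then have "s * b = a"
    by (simp only: to_fract_eq_iff)
  then show ?thesis
    using as that by blast
qed

text \<open>The powers start at \<open>b\<close>: the trivial relation \<open>1 \<in> A\<close> would be of no use.\<close>

lemma integral_relation:
  obtains n c where "\<And>i. c i \<in> A" "b ^ Suc n = (\<Sum>i\<le>n. c i * b ^ i)"
proof -
  obtain n where n: "b ^ Suc n \<in> span (A \<union> (\<lambda>i. b ^ Suc i) ` {..<n})"
    using sequence_dependent_modulo[OF finite_G, of "\<lambda>i. b ^ Suc i" A] span_G by blast
  \<comment> \<open>\<open>T\<close> is the \<open>A\<close>-module generated by
    \<open>1, b, ..., b ^ n\<close>. It contains \<open>A\<close> through the exponent 0 and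
    \<open>b ^ Suc j\<close> for \<open>j < n\<close>, hence all the spanning vectors.\<close>
  define T where "T = {\<Sum>i\<le>n. c i * b ^ i | c. \<forall>i. c i \<in> A}"
  have TI: "y \<in> T" if "\<And>i. c i \<in> A" "y = (\<Sum>i\<le>n. c i * b ^ i)" for y and c :: "nat \<Rightarrow> 'b"
    using that by (auto simp: T_def)
  have "subspace T"
  proof (rule subspaceI)
    show "0 \<in> T"
      by (rule TI[of "\<lambda>_. 0"]) (auto simp: zero_A)
  next
    fix x y assume "x \<in> T" "y \<in> T"
    then obtain c d where cd: "\<And>i. c i \<in> A" "\<And>i. d i \<in> A"
      "x = (\<Sum>i\<le>n. c i * b ^ i)" "y = (\<Sum>i\<le>n. d i * b ^ i)"
      unfolding T_def by blast
    then show "x + y \<in> T"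
      by (intro TI[of "\<lambda>i. c i + d i"]) (auto simp: add_A sum.distrib distrib_right)
  next
    fix k x assume "x \<in> T"
    then obtain c where "\<And>i. c i \<in> A" "x = (\<Sum>i\<le>n. c i * b ^ i)"
      unfolding T_def by blast
    then show "k *s x \<in> T"
      by (intro TI[of "\<lambda>i. k *s c i"]) (auto simp: scale_A scale_sum_right scale_mult)
  qed
  moreover have "a \<in> T" if "a \<in> A" for a
    by (rule TI[of "\<lambda>i. if i = 0 then a else 0"])
       (auto simp: that zero_A if_distrib[of "\<lambda>x. x * _"] cong: if_cong)
  moreover have "b ^ Suc j \<in> T" if "j < n" for j
    by (rule TI[of "\<lambda>i. if i = Suc j then 1 else 0"])
       (use that in \<open>auto simp: one_A zero_A if_distrib[of "\<lambda>x. x * _"] cong: if_cong\<close>)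
  ultimately have "span (A \<union> (\<lambda>i. b ^ Suc i) ` {..<n}) \<subseteq> T"
    by (intro span_minimal) auto
  then have "b ^ Suc n \<in> T"
    using n by blast
  then show ?thesis
    unfolding T_def using that by blast
qed

text \<open>The witness is \<open>X ^ Suc n\<close> minus the polynomial \<open>q\<close> with
  coefficients \<open>c i\<close>; it is monic because \<open>q\<close> has degree at most
  \<open>n\<close>.\<close>

lemma monic_relation_imp_integral:
  fixes z :: "'b fract"
  assumes "z ^ Suc n = (\<Sum>i\<le>n. to_fract (c i) * z ^ i)"
  shows "integral_element z"
proof -
  define q where "q = (\<Sum>i\<le>n. monom (c i) i)"
  have "degree q \<le> n"
    unfolding q_def by (intro degree_sum_le) (auto intro: order.trans[OF degree_monom_le])
  then have "degree q < degree (monom (1::'b) (Suc n))"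
    by (simp add: degree_monom_eq)
  then have deg: "degree (monom 1 (Suc n) - q) = Suc n" and q0: "coeff q (Suc n) = 0"
    using degree_add_eq_left[of "- q" "monom 1 (Suc n)"]
    by (auto simp: degree_monom_eq coeff_eq_0)
  have "lead_coeff (monom 1 (Suc n) - q) = 1"
    unfolding deg by (simp add: q0)
  moreover have "map_poly to_fract (monom 1 (Suc n) - q) =
      monom 1 (Suc n) - (\<Sum>i\<le>n. monom (to_fract (c i)) i)"
    by (intro poly_eqI) (auto simp: coeff_map_poly q_def coeff_sum)
  then have "poly (map_poly to_fract (monom 1 (Suc n) - q)) z = 0"
    using assms by (simp add: poly_monom poly_sum)
  ultimately show ?thesis
    unfolding integral_element_def by blast
qed

text \<open>The quotient of \<open>f (s * b)\<close> by \<open>f s\<close>, formed in the fraction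
  field, satisfies a monic equation with coefficients \<open>f (c i)\<close>, so integral closedness
  puts it into the domain.\<close>

lemma extension_exists:
  assumes s: "s \<in> A" "s \<noteq> 0" and sb: "s * b \<in> A"
  shows "\<exists>y. f s * y = f (s * b)"
proof -
  obtain n c where c: "\<And>i. c i \<in> A" and b: "b ^ Suc n = (\<Sum>i\<le>n. c i * b ^ i)"
    using integral_relation[of b] by blast
  \<comment> \<open>\<open>b\<close> need not lie in \<open>A\<close>, so \<open>f\<close> cannot be
    applied to its relation directly. After multiplication by \<open>s ^ Suc n\<close> every factor
    lies in \<open>A\<close>.\<close>
  have "(s * b) ^ Suc n = s ^ Suc n * (\<Sum>i\<le>n. c i * b ^ i)"
    by (simp only: power_mult_distrib b)
  also have "\<dots> = (\<Sum>i\<le>n. c i * (s * b) ^ i * s ^ (Suc n - i))"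
    unfolding sum_distrib_left
  proof (rule sum.cong)
    fix i assume "i \<in> {..n}"
    then have "s ^ Suc n = s ^ i * s ^ (Suc n - i)"
      by (simp flip: power_add)
    then show "s ^ Suc n * (c i * b ^ i) = c i * (s * b) ^ i * s ^ (Suc n - i)"
      by (simp only: power_mult_distrib mult_ac)
  qed simp
  finally have "f ((s * b) ^ Suc n) = f (\<Sum>i\<le>n. c i * (s * b) ^ i * s ^ (Suc n - i))"
    by simp
  also have "\<dots> = (\<Sum>i\<le>n. f (c i * (s * b) ^ i * s ^ (Suc n - i)))"
    by (rule f_sum) (intro mult_A power_A c s sb)
  finally have rel: "f (s * b) ^ Suc n = (\<Sum>i\<le>n. f (c i) * f (s * b) ^ i * f s ^ (Suc n - i))"
    by (simp only: f_mult f_power mult_A power_A c s sb)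
  define u v where "u = to_fract (f (s * b))" and "v = to_fract (f s)"
  have v: "v \<noteq> 0"
    using s by (simp add: v_def f_eq_0_iff)
  have hom_power: "to_fract (x ^ m) = to_fract x ^ m" for x :: 'b and m
    by (induction m) auto
  have hom_sum: "to_fract (sum g I) = (\<Sum>i\<in>I. to_fract (g i))" for g :: "nat \<Rightarrow> 'b" and I
    by (induction I rule: infinite_finite_induct) auto
  have rel': "u ^ Suc n = (\<Sum>i\<le>n. to_fract (f (c i)) * u ^ i * v ^ (Suc n - i))"
    unfolding u_def v_def by (simp only: hom_power[symmetric] rel hom_sum to_fract_mult)
  have "(u / v) ^ Suc n = (\<Sum>i\<le>n. to_fract (f (c i)) * u ^ i * v ^ (Suc n - i)) / v ^ Suc n"
    by (simp only: power_divide rel')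
  also have "\<dots> = (\<Sum>i\<le>n. to_fract (f (c i)) * (u / v) ^ i)"
    unfolding sum_divide_distrib
  proof (rule sum.cong)
    fix i assume "i \<in> {..n}"
    then have "v ^ Suc n = v ^ i * v ^ (Suc n - i)"
      by (simp flip: power_add)
    then show "to_fract (f (c i)) * u ^ i * v ^ (Suc n - i) / v ^ Suc n
        = to_fract (f (c i)) * (u / v) ^ i"
      using v by (simp add: power_divide)
  qed simp
  finally have "integral_element (u / v)"
    by (rule monic_relation_imp_integral)
  then have "u / v \<in> range to_fract"
    using closed unfolding integrally_closed_def by blast
  then obtain y where "u / v = to_fract y"
    by blast
  then have "to_fract (f s * y) = to_fract (f (s * b))"
    using v by (simp add: u_def v_def field_simps)
  then show ?thesis
    by (auto simp only: to_fract_eq_iff)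
qed

text \<open>Quantifying over all denominators avoids choosing one. The case \<open>s = 0\<close> is
  harmless, as both sides of the equation then vanish.\<close>

definition ext :: "'b \<Rightarrow> 'b" where
  "ext b = (THE y. \<forall>s\<in>A. s * b \<in> A \<longrightarrow> f s * y = f (s * b))"

text \<open>Cross-multiplication: \<open>t * (s * b) = s * (t * b)\<close> is a product of elements
  of \<open>A\<close> in two ways, and \<open>f s\<close> cancels by injectivity of
  \<open>f\<close>.\<close>

lemma extension_independent:
  assumes s: "s \<in> A" "s \<noteq> 0" "s * b \<in> A" and t: "t \<in> A" "t * b \<in> A"
    and y: "f s * y = f (s * b)"
  shows "f t * y = f (t * b)"
proof -
  have "f s * (f t * y) = f t * f (s * b)"
    using y by (simp add: mult_ac)
  also have "\<dots> = f (t * (s * b))"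
    using s t by (simp add: f_mult)
  also have "t * (s * b) = s * (t * b)"
    by (simp add: mult_ac)
  also have "f \<dots> = f s * f (t * b)"
    using s t by (simp add: f_mult)
  finally show ?thesis
    using s by (simp add: f_eq_0_iff)
qed

lemma ext_denominator:
  assumes "t \<in> A" "t * b \<in> A"
  shows "f t * ext b = f (t * b)"
proof -
  obtain s where s: "s \<in> A" "s \<noteq> 0" "s * b \<in> A"
    by (rule denominator)
  obtain y where y: "f s * y = f (s * b)"
    using extension_exists[OF s] by blast
  have "\<forall>s\<in>A. s * b \<in> A \<longrightarrow> f s * ext b = f (s * b)"
    unfolding ext_def
  proof (rule theI)
    show "\<forall>t\<in>A. t * b \<in> A \<longrightarrow> f t * y = f (t * b)"
      using extension_independent[OF s _ _ y] by blast
  next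
    fix z assume "\<forall>s\<in>A. s * b \<in> A \<longrightarrow> f s * z = f (s * b)"
    then have "f s * z = f s * y"
      using s y by simp
    then show "z = y"
      using s by (simp add: f_eq_0_iff)
  qed
  then show ?thesis
    using assms by blast
qed

text \<open>A value of \<open>ext\<close> can be checked on a single nonzero denominator; for sums
  and products this will be the product of two denominators.\<close>

lemma ext_eqI:
  assumes "s \<in> A" "s \<noteq> 0" "s * b \<in> A" "f s * y = f (s * b)"
  shows "ext b = y"
proof -
  have "f s * ext b = f s * y"
    using ext_denominator assms by simp
  then show ?thesis
    using assms(1,2) by (simp add: f_eq_0_iff)
qed

section \<open>The extension is an injective Poisson endomorphism\<close>

lemma ext_A: "a \<in> A \<Longrightarrow> ext a = f a"
  by (rule ext_eqI[of 1]) (auto simp: one_A f_1)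

lemma ext_add: "ext (x + y) = ext x + ext y"
proof -
  obtain s where s: "s \<in> A" "s \<noteq> 0" "s * x \<in> A"
    by (rule denominator)
  obtain t where t: "t \<in> A" "t \<noteq> 0" "t * y \<in> A"
    by (rule denominator)
  have eq: "s * t * (x + y) = t * (s * x) + s * (t * y)"
    by (simp add: algebra_simps)
  show ?thesis
  proof (rule ext_eqI[of "s * t"])
    show "s * t * (x + y) \<in> A"
      unfolding eq using s t by (simp add: add_A mult_A)
    have "f (s * t * (x + y)) = f t * f (s * x) + f s * f (t * y)"
      unfolding eq using s t by (simp add: f_add f_mult mult_A)
    also have "\<dots> = f t * (f s * ext x) + f s * (f t * ext y)"
      using s t by (simp add: ext_denominator)
    also have "\<dots> = f (s * t) * (ext x + ext y)"
      using s t by (simp add: f_mult algebra_simps)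
    finally show "f (s * t) * (ext x + ext y) = f (s * t * (x + y))" ..
  qed (use s t in \<open>auto simp: mult_A\<close>)
qed

lemma ext_mult: "ext (x * y) = ext x * ext y"
proof -
  obtain s where s: "s \<in> A" "s \<noteq> 0" "s * x \<in> A"
    by (rule denominator)
  obtain t where t: "t \<in> A" "t \<noteq> 0" "t * y \<in> A"
    by (rule denominator)
  have eq: "s * t * (x * y) = (s * x) * (t * y)"
    by (simp add: algebra_simps)
  show ?thesis
  proof (rule ext_eqI[of "s * t"])
    show "s * t * (x * y) \<in> A"
      unfolding eq using s t by (simp only: mult_A)
    have "f (s * t * (x * y)) = (f s * ext x) * (f t * ext y)"
      unfolding eq using s t by (simp only: f_mult ext_denominator)
    also have "\<dots> = f (s * t) * (ext x * ext y)"
      using s t by (simp add: f_mult algebra_simps)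
    finally show "f (s * t) * (ext x * ext y) = f (s * t * (x * y))" ..
  qed (use s t in \<open>auto simp: mult_A\<close>)
qed

text \<open>Scalars act as multiplication by \<open>c *s 1\<close>, an element of \<open>A\<close>
  fixed by \<open>f\<close>, so multiplicativity suffices.\<close>

lemma ext_scale: "ext (c *s x) = c *s ext x"
proof -
  have "ext (c *s x) = ext (c *s 1) * ext x"
    by (subst scale_eq_mult) (rule ext_mult)
  also have "ext (c *s 1) = c *s 1"
    by (simp add: ext_A scale_A one_A f_scale f_1)
  finally show ?thesis
    by (simp add: scale_mult)
qed

lemma ext_minus: "ext (- x) = - ext x"
  using ext_scale[of "-1" x] by simp

lemma ext_inj: "inj ext"
proof (rule injI)
  fix x y assume "ext x = ext y"
  then have 0: "ext (x - y) = 0"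
    using ext_add[of x "- y"] by (simp add: ext_minus)
  obtain s where s: "s \<in> A" "s \<noteq> 0" "s * (x - y) \<in> A"
    by (rule denominator)
  then have "s * (x - y) = 0"
    using ext_denominator[of s "x - y"] 0 f_eq_0_iff by simp
  then show "x = y"
    using s by simp
qed

text \<open>The Leibniz rule for \<open>bracket (s * b) x\<close> isolates
  \<open>s * bracket b x\<close>; the factor \<open>ext s = f s\<close> is nonzero and
  cancels.\<close>

lemma ext_bracket_cancel:
  assumes s: "s \<in> A" "s \<noteq> 0"
    and 1: "ext (bracket s x) = bracket (ext s) (ext x)"
    and 2: "ext (bracket (s * b) x) = bracket (ext (s * b)) (ext x)"
  shows "ext (bracket b x) = bracket (ext b) (ext x)"
proof -
  have "ext s * ext (bracket b x) + ext b * bracket (ext s) (ext x)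
      = ext (bracket (s * b) x)"
    by (simp add: bracket_mult_left ext_add ext_mult 1)
  also have "\<dots> = ext s * bracket (ext b) (ext x) + ext b * bracket (ext s) (ext x)"
    by (simp only: 2) (simp only: ext_mult bracket_mult_left)
  finally have "ext s * ext (bracket b x) = ext s * bracket (ext b) (ext x)"
    by simp
  then show ?thesis
    using s by (simp add: ext_A f_eq_0_iff)
qed

text \<open>Denominators are cleared one argument at a time: first on the left with the right
  argument in \<open>A\<close>, then, after antisymmetry has swapped the roles, on the left again
  with an arbitrary right argument.\<close>

lemma ext_bracket: "ext (bracket x y) = bracket (ext x) (ext y)"
proof -
  have A: "ext (bracket b a) = bracket (ext b) (ext a)" if "a \<in> A" for a b
  proof -
    obtain s where s: "s \<in> A" "s \<noteq> 0" "s * b \<in> A"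
      by (rule denominator)
    show ?thesis
      by (rule ext_bracket_cancel[of s]) (use s that in \<open>simp_all add: ext_A bracket_A f_bracket\<close>)
  qed
  have A': "ext (bracket a b) = bracket (ext a) (ext b)" if "a \<in> A" for a b
    using A[OF that, of b] bracket_antisym[of a b] bracket_antisym[of "ext a" "ext b"]
    by (simp add: ext_minus)
  obtain s where s: "s \<in> A" "s \<noteq> 0" "s * x \<in> A"
    by (rule denominator)
  show ?thesis
    by (rule ext_bracket_cancel[of s]) (use s A' in auto)
qed

lemma ext_endo: "poisson_endo_on scale bracket UNIV ext"
  unfolding poisson_endo_on_def
  by (simp add: ext_A one_A f_1 ext_add ext_scale ext_mult ext_bracket)

lemma surj_on_A:
  assumes "dixmier_on scale bracket UNIV"
  shows "f ` A = A"
proof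
  show "f ` A \<subseteq> A"
    using f_A by blast
  have "surj ext"
    using assms ext_endo ext_inj unfolding dixmier_on_def bij_betw_def by blast
  show "A \<subseteq> f ` A"
  proof
    fix a assume a: "a \<in> A"
    obtain x where x: "a = ext x"
      using \<open>surj ext\<close> by (metis surjD)
    have "x \<in> A"
    proof (rule surj_preimage_finite_codim[OF subspace_A finite_G span_G ext_add ext_scale])
      show "ext ` A \<subseteq> A"
        by (auto simp: ext_A f_A)
    qed (use \<open>surj ext\<close> a x in auto)
    then show "a \<in> f ` A"
      using x ext_A by blast
  qed
qed

end

section \<open>A finite spanning set modulo \<open>A\<close>, and the conclusion\<close>

lemma (in poisson_algebra) finite_dim_quotient_spanning:
  assumes "finite_dim_quotient scale A" and "subspace A"
  obtains G where "finite G" "span (A \<union> G) = UNIV"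
proof -
  obtain G where G: "finite G"
    and "\<forall>C\<in>range (\<lambda>b. b +o A). \<exists>c. C = (\<Sum>v\<in>G. c v *s v) +o A"
    using assms(1) unfolding finite_dim_quotient_def by (elim exE conjE)
  then have coset: "\<exists>c. b +o A = (\<Sum>v\<in>G. c v *s v) +o A" for b
    by (simp only: ball_simps)
  have "b \<in> span (A \<union> G)" for b
  proof -
    obtain c where "b +o A = (\<Sum>v\<in>G. c v *s v) +o A"
      using coset by blast
    \<comment> \<open>Since \<open>0 \<in> A\<close>, the equality of cosets yields a decomposition
      of the element \<open>b\<close> itself.\<close>
    moreover have "b \<in> b +o A"
      using subspace_0[OF assms(2)] by (force simp: elt_set_plus_def)
    ultimately obtain a where "a \<in> A" "b = (\<Sum>v\<in>G. c v *s v) + a"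
      by (auto simp: elt_set_plus_def)
    then show ?thesis
      by (auto intro!: span_add span_sum span_scale intro: span_base)
  qed
  with G show ?thesis
    using that by blast
qed

theorem theorem0p9:
  fixes scale :: "'k::field_char_0 \<Rightarrow> 'b::idom \<Rightarrow> 'b"
    and bracket :: "'b \<Rightarrow> 'b \<Rightarrow> 'b"
    and A :: "'b set"
  assumes "poisson_algebra scale bracket"
    and "integrally_closed TYPE('b)"
    and "dixmier_on scale bracket UNIV"
    and "poisson_subalgebra scale bracket A"
    and "finite_dim_quotient scale A"
    and "range to_fract \<subseteq> fraction_field_of A"
  shows "dixmier_on scale bracket A"
  unfolding dixmier_on_def
proof (intro allI impI)
  fix f assume f: "poisson_endo_on scale bracket A f" "inj_on f A"
  interpret poisson_algebra scale bracket by fact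
  have "subspace A"
    using assms(4) by (simp add: poisson_subalgebra_def)
  then obtain G where "finite G" "span (A \<union> G) = UNIV"
    using finite_dim_quotient_spanning assms(5) by blast
  then interpret poisson_endo_extension scale bracket A G f
    using assms f by unfold_locales
  show "bij_betw f A A"
    using f(2) surj_on_A[OF assms(3)] by (simp add: bij_betw_def)
qed

end
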